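(* Let $A$ be a left-symmetric conformal algebra and let $\omega^1_\lambda,\omega^2_\lambda:A\times A\to A^{*c}[\lambda]$ be two invariant $2$-cocycles with coefficients in the module $A^{*c}_L=(A^{*c},L^*_A,0)$. Then: (i) $T^*_{\omega^1}A$ is equivalent to $T^*_{\omega^2}A$ if and only if there exists $\theta\in C^1(A,A^{*c})$ such that $$\omega^1_\lambda(a,b)-\omega^2_\lambda(a,b)=L^*_A(a)_\lambda\theta(b)-\theta(a_\lambda b),\qquad\forall\,a,b\in A.\qquad(\ast)$$ In this case, $\beta_\lambda(a,b):=\frac12\big(\theta(a)_\lambda b+\theta(b)_{-\lambda}a\big)$ is a symmetric invariant conformal bilinear form on $A$. Furthermore, $\omega^1=\omega^2$ if and only if $\theta$ is a $1$-cocycle with coefficients in $A^{*c}_L$. (ii) $T^*_{\omega^1}A$ is isometrically equivalent to $T^*_{\omega^2}A$ if and only if there exists $\theta\in C^1(A,A^{*c})$ such that $(\ast)$ holds and the bilinear form $\beta$ induced by $\theta$ on $A$ vanishes.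
   Context: $A$ is finitely generated as a $\mathbb{C}[\partial]$-module. Products and actions are extended coefficientwise to polynomials in $\lambda,\mu$. A left-symmetric conformal algebra is a $\mathbb{C}[\partial]$-module $A$ with a $\mathbb{C}$-linear map $A\otimes A\to A[\lambda]$, $a\otimes b\mapsto a_\lambda b$, such that $(\partial a)_\lambda b=-\lambda a_\lambda b$, $a_\lambda(\partial b)=(\partial+\lambda)a_\lambda b$ and $(a_\lambda b)_{\lambda+\mu}c-a_\lambda(b_\mu c)=(b_\mu a)_{\lambda+\mu}c-b_\mu(a_\lambda c)$. Homomorphisms are $\mathbb{C}[\partial]$-module homomorphisms preserving the $\lambda$-products. The conformal dual $A^{*c}$ is the space of $\mathbb{C}$-linear maps $f_\lambda:A\to\mathbb{C}[\lambda]$ with $f_\lambda(\partial a)=\lambda f_\lambda(a)$, a $\mathbb{C}[\partial]$-module via $(\partial f)_\lambda=-\lambda f_\lambda$. Define $L^*_A(a)_\lambda f\in A^{*c}[\lambda]$ by $\big(L^*_A(a)_\lambda f\big)_{\lambda+\mu}b=-f_\mu(a_\lambda b)$. $A^{*c}_L=(A^{*c},L^*_A,0)$ is the $A$-module $A^{*c}$ with left action $a_\lambda f=L^*_A(a)_\lambda f$ and zero right action. $C^1(A,A^{*c})$ is the space of $\mathbb{C}[\partial]$-module homomorphisms $\theta:A\to A^{*c}$; $\theta$ is a $1$-cocycle with coefficients in $A^{*c}_L$ if $L^*_A(a)_\lambda\theta(b)-\theta(a_\lambda b)=0$ for all $a,b$. A $2$-cocycle with coefficients in $A^{*c}_L$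 is a $\mathbb{C}$-bilinear map $\omega_\lambda:A\times A\to A^{*c}[\lambda]$ with $\omega_\lambda(\partial a,b)=-\lambda\omega_\lambda(a,b)$, $\omega_\lambda(a,\partial b)=(\partial+\lambda)\omega_\lambda(a,b)$ and $$L^*_A(a)_\lambda\omega_\mu(b,c)-L^*_A(b)_\mu\omega_\lambda(a,c)-\omega_\mu(b,a_\lambda c)+\omega_\lambda(a,b_\mu c)-\omega_{\lambda+\mu}(a_\lambda b,c)+\omega_{\lambda+\mu}(b_\mu a,c)=0.$$ It is invariant if for all $a,b,c\in A$ $$\omega_\lambda(a,b)_{\lambda+\mu}c-\omega_\mu(b,c)_{-\lambda}a=\omega_\mu(b,a)_{\lambda+\mu}c-\omega_\lambda(a,c)_{-\mu}b.$$ A conformal bilinear form on a left-symmetric conformal algebra $A$ is a $\mathbb{C}$-bilinear map $B_\lambda:A\times A\to\mathbb{C}[\lambda]$ with $B_\lambda(\partial a,b)=-\lambda B_\lambda(a,b)$, $B_\lambda(a,\partial b)=\lambda B_\lambda(a,b)$. It is symmetric if $B_\lambda(a,b)=B_{-\lambda}(b,a)$, and invariant if $B_{\lambda+\mu}(a_\lambda b,c)-B_\lambda(a,b_\mu c)=B_{\lambda+\mu}(b_\mu a,c)-B_\mu(b,a_\lambda c)$. For an invariant $2$-cocycle $\omega$, the $T^*$-extension $T^*_\omega A$ is the left-symmetric conformal algebra $A\oplus A^{*c}$ with $\lambda$-product $(a+f)\cdot^\omega_\lambda(b+g)=a_\lambda b+\omega_\lambda(a,b)+L^*_A(a)_\lambda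 g$, together with the symmetric bilinear form $B_\lambda(a+f,b+g)=f_\lambda(b)+g_{-\lambda}(a)$. $A^{*c}$ is an ideal of it, with quotient $A$. $T^*_{\omega^1}A$ and $T^*_{\omega^2}A$ are equivalent if there is an isomorphism of left-symmetric conformal algebras $\Phi:T^*_{\omega^1}A\to T^*_{\omega^2}A$ which is the identity on $A^{*c}$ and induces the identity on the quotient $T^*_{\omega^1}A/A^{*c}\cong A\cong T^*_{\omega^2}A/A^{*c}$ (i.e. $\Phi(a)-a\in A^{*c}$ for $a\in A$). They are isometrically equivalent if such a $\Phi$ can be chosen which is an isometry, i.e. $B_\lambda(\Phi(x),\Phi(y))=B_\lambda(x,y)$ for all $x,y\in A\oplus A^{*c}$. *)

theory Defs
  imports "HOL-Computational_Algebra.Polynomial" "HOL-Library.Function_Algebras"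
    "HOL-Library.Product_Plus"
begin

section \<open>Modules over the polynomial ring in the derivation\<close>

text \<open>
  The ring of polynomials in the derivation is \<open>complex poly\<close>, its variable \<open>[:0, 1:]\<close> acting as
  the derivation.  A module is a carrier inside a type on which \<open>complex poly\<close> acts; the explicit
  carrier is needed because the conformal dual and the extended algebra depend on the algebra, so
  that they cannot be types of their own.
\<close>

record 'a conf_mod =
  carr :: "'a set"
  act :: "complex poly \<Rightarrow> 'a \<Rightarrow> 'a"

definition is_conf_mod :: "('a::ab_group_add, 'z) conf_mod_scheme \<Rightarrow> bool" where
  "is_conf_mod V \<longleftrightarrow> module (act V) \<and> module.subspace (act V) (carr V)"

definition fin_gen :: "('a::ab_group_add, 'z) conf_mod_scheme \<Rightarrow> bool" where
  "fin_gen V \<longleftrightarrow> (\<exists>S. finite S \<and> module.span (act V) S = carr V)"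

definition csc :: "('a, 'z) conf_mod_scheme \<Rightarrow> complex \<Rightarrow> 'a \<Rightarrow> 'a" where
  "csc V c x = act V [:c:] x"

definition der :: "('a, 'z) conf_mod_scheme \<Rightarrow> 'a \<Rightarrow> 'a" where
  "der V x = act V [:0, 1:] x"

definition linear_on ::
  "'a::plus set \<Rightarrow> ('r \<Rightarrow> 'a \<Rightarrow> 'a) \<Rightarrow> ('r \<Rightarrow> 'b::plus \<Rightarrow> 'b) \<Rightarrow> ('a \<Rightarrow> 'b) \<Rightarrow> bool" where
  "linear_on X s t f \<longleftrightarrow>
     (\<forall>x\<in>X. \<forall>y\<in>X. f (x + y) = f x + f y) \<and> (\<forall>r. \<forall>x\<in>X. f (s r x) = t r (f x))"

definition conf_mod_hom ::
  "('a::plus, 'y) conf_mod_scheme \<Rightarrow> ('b::plus, 'z) conf_mod_scheme \<Rightarrow> ('a \<Rightarrow> 'b) \<Rightarrow> bool" where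
  "conf_mod_hom V W h \<longleftrightarrow> (\<forall>x\<in>carr V. h x \<in> carr W) \<and> linear_on (carr V) (act V) (act W) h"


section \<open>Polynomials in one and two variables with coefficients in a module\<close>

definition polys :: "('a::zero, 'z) conf_mod_scheme \<Rightarrow> 'a poly set" where
  "polys V = {P. \<forall>n. coeff P n \<in> carr V}"

text \<open>
  Polynomials in lambda and mu are iterated polynomials: the outer variable is lambda, the inner
  one is mu.
\<close>

definition lam :: "complex poly poly" where "lam = [:0, 1:]"

definition mu :: "complex poly poly" where "mu = [:[:0, 1:]:]"

text \<open>
  \<open>psub s r P\<close> substitutes \<open>r\<close> for the variable of \<open>P\<close>, where \<open>s\<close> is the action of the complex
  numbers on the coefficients: the coefficient of degree \<open>n\<close> is tensored with \<open>r ^ n\<close>.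
\<close>

definition psub ::
  "(complex \<Rightarrow> 'a \<Rightarrow> 'a) \<Rightarrow> complex poly poly \<Rightarrow> 'a::comm_monoid_add poly \<Rightarrow> 'a poly poly" where
  "psub s r P = (\<Sum>n\<le>degree P. map_poly (map_poly (\<lambda>c. s c (coeff P n))) (r ^ n))"

text \<open>
  \<open>pext h P\<close> is the coefficientwise extension of \<open>h\<close> to polynomials in lambda and mu: the value of
  \<open>h\<close> at the coefficient of \<open>lam ^ i * mu ^ j\<close> is multiplied by \<open>lam ^ i * mu ^ j\<close>, which shifts the
  outer coefficients by \<open>i\<close> and the inner ones by \<open>j\<close>.  For example, the double product
  \<open>(a _lambda b) _(lambda + mu) c\<close> is
  \<open>pext (\<lambda>x. psub s (lam + mu) (lprod A x c)) (psub s lam (lprod A a b))\<close> where \<open>s = csc A\<close>.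
\<close>

definition pext ::
  "('a::zero \<Rightarrow> 'b::comm_monoid_add poly poly) \<Rightarrow> 'a poly poly \<Rightarrow> 'b poly poly" where
  "pext h P =
     (\<Sum>i\<le>degree P. \<Sum>j\<le>degree (coeff P i).
        (pCons 0 ^^ i) (map_poly (pCons 0 ^^ j) (h (coeff (coeff P i) j))))"

text \<open>Substitution of minus the variable in a scalar polynomial.\<close>

definition pneg :: "complex poly \<Rightarrow> complex poly" where
  "pneg p = pcompose p [:0, -1:]"


section \<open>Left-symmetric conformal algebras\<close>

record (overloaded) ('a::zero) conf_alg = "'a conf_mod" +
  lprod :: "'a \<Rightarrow> 'a \<Rightarrow> 'a poly"

definition bilinear_on ::
  "('a::ab_group_add, 'y) conf_mod_scheme \<Rightarrow> (complex \<Rightarrow> 'b::ab_group_add \<Rightarrow> 'b)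
     \<Rightarrow> ('a \<Rightarrow> 'a \<Rightarrow> 'b) \<Rightarrow> bool" where
  "bilinear_on V t w \<longleftrightarrow>
     (\<forall>b\<in>carr V. linear_on (carr V) (csc V) t (\<lambda>a. w a b)) \<and>
     (\<forall>a\<in>carr V. linear_on (carr V) (csc V) t (\<lambda>b. w a b))"

text \<open>
  Bilinear maps from \<open>V\<close> to polynomials over \<open>W\<close> with the sesquilinearity common to lambda-products
  and 2-cocycles.  Multiplication by lambda is \<open>pCons 0\<close>.
\<close>

definition conf_sesquilinear ::
  "('a::ab_group_add, 'y) conf_mod_scheme \<Rightarrow> ('b::ab_group_add, 'z) conf_mod_scheme
     \<Rightarrow> ('a \<Rightarrow> 'a \<Rightarrow> 'b poly) \<Rightarrow> bool" where
  "conf_sesquilinear V W w \<longleftrightarrow>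
     (\<forall>a\<in>carr V. \<forall>b\<in>carr V. w a b \<in> polys W) \<and>
     bilinear_on V (\<lambda>c. map_poly (csc W c)) w \<and>
     (\<forall>a\<in>carr V. \<forall>b\<in>carr V. w (der V a) b = - pCons 0 (w a b)) \<and>
     (\<forall>a\<in>carr V. \<forall>b\<in>carr V. w a (der V b) = map_poly (der W) (w a b) + pCons 0 (w a b))"

definition lsca :: "'a::ab_group_add conf_alg \<Rightarrow> bool" where
  "lsca A \<longleftrightarrow> is_conf_mod A \<and> conf_sesquilinear A A (lprod A) \<and>
     (\<forall>a\<in>carr A. \<forall>b\<in>carr A. \<forall>c\<in>carr A.
        pext (\<lambda>x. psub (csc A) (lam + mu) (lprod A x c)) (psub (csc A) lam (lprod A a b))
      - pext (\<lambda>x. psub (csc A) lam (lprod A a x)) (psub (csc A) mu (lprod A b c))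
      = pext (\<lambda>x. psub (csc A) (lam + mu) (lprod A x c)) (psub (csc A) mu (lprod A b a))
      - pext (\<lambda>x. psub (csc A) mu (lprod A b x)) (psub (csc A) lam (lprod A a c)))"

definition lsca_hom ::
  "'a::ab_group_add conf_alg \<Rightarrow> 'b::ab_group_add conf_alg \<Rightarrow> ('a \<Rightarrow> 'b) \<Rightarrow> bool" where
  "lsca_hom A B h \<longleftrightarrow> conf_mod_hom A B h \<and>
     (\<forall>x\<in>carr A. \<forall>y\<in>carr A. map_poly h (lprod A x y) = lprod B (h x) (h y))"

definition lsca_iso ::
  "'a::ab_group_add conf_alg \<Rightarrow> 'b::ab_group_add conf_alg \<Rightarrow> ('a \<Rightarrow> 'b) \<Rightarrow> bool" where
  "lsca_iso A B h \<longleftrightarrow> lsca_hom A B h \<and> bij_betw h (carr A) (carr B)"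


section \<open>The conformal dual\<close>

text \<open>
  A functional on \<open>carr V\<close> is represented by its extension by zero, so that equality of functions
  is equality of functionals.
\<close>

definition cdual ::
  "('a::ab_group_add, 'z) conf_mod_scheme \<Rightarrow> ('a \<Rightarrow> complex poly) conf_mod" where
  "cdual V =
     \<lparr>carr = {f. linear_on (carr V) (csc V) smult f \<and>
                 (\<forall>a\<in>carr V. f (der V a) = [:0, 1:] * f a) \<and> (\<forall>a. a \<notin> carr V \<longrightarrow> f a = 0)},
      act = (\<lambda>p f a. pneg p * f a)\<rparr>"

text \<open>
  \<open>lstar A a f\<close> is the dual left action, a polynomial over the dual.  It is characterised by its
  defining identity; see \<open>lstar_unique\<close> and \<open>lstar_exists\<close> below for well-definedness.
\<close>

definition is_lstar ::
  "'a::ab_group_add conf_alg \<Rightarrow> 'a \<Rightarrow> ('a \<Rightarrow> complex poly) \<Rightarrow> ('a \<Rightarrow> complex poly) poly \<Rightarrow> bool" where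
  "is_lstar A a f P \<longleftrightarrow> P \<in> polys (cdual A) \<and>
     (\<forall>b\<in>carr A.
        pext (\<lambda>g. psub (*) (lam + mu) (g b)) (psub (csc (cdual A)) lam P)
      = - pext (\<lambda>x. psub (*) mu (f x)) (psub (csc A) lam (lprod A a b)))"

definition lstar ::
  "'a::ab_group_add conf_alg \<Rightarrow> 'a \<Rightarrow> ('a \<Rightarrow> complex poly) \<Rightarrow> ('a \<Rightarrow> complex poly) poly" where
  "lstar A a f = (THE P. is_lstar A a f P)"


section \<open>Cochains and cocycles with coefficients in the dual\<close>

definition C1 :: "'a::ab_group_add conf_alg \<Rightarrow> ('a \<Rightarrow> 'a \<Rightarrow> complex poly) set" where
  "C1 A = {\<theta>. conf_mod_hom A (cdual A) \<theta>}"

definition cobdry ::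
  "'a::ab_group_add conf_alg \<Rightarrow> ('a \<Rightarrow> 'a \<Rightarrow> complex poly) \<Rightarrow> 'a \<Rightarrow> 'a \<Rightarrow> ('a \<Rightarrow> complex poly) poly" where
  "cobdry A \<theta> a b = lstar A a (\<theta> b) - map_poly \<theta> (lprod A a b)"

definition one_cocycle :: "'a::ab_group_add conf_alg \<Rightarrow> ('a \<Rightarrow> 'a \<Rightarrow> complex poly) \<Rightarrow> bool" where
  "one_cocycle A \<theta> \<longleftrightarrow> \<theta> \<in> C1 A \<and> (\<forall>a\<in>carr A. \<forall>b\<in>carr A. cobdry A \<theta> a b = 0)"

definition two_cocycle ::
  "'a::ab_group_add conf_alg \<Rightarrow> ('a \<Rightarrow> 'a \<Rightarrow> ('a \<Rightarrow> complex poly) poly) \<Rightarrow> bool" where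
  "two_cocycle A \<omega> \<longleftrightarrow> conf_sesquilinear A (cdual A) \<omega> \<and>
     (let s = csc A; t = csc (cdual A) in
      \<forall>a\<in>carr A. \<forall>b\<in>carr A. \<forall>c\<in>carr A.
        pext (\<lambda>f. psub t lam (lstar A a f)) (psub t mu (\<omega> b c))
      - pext (\<lambda>f. psub t mu (lstar A b f)) (psub t lam (\<omega> a c))
      - pext (\<lambda>x. psub t mu (\<omega> b x)) (psub s lam (lprod A a c))
      + pext (\<lambda>x. psub t lam (\<omega> a x)) (psub s mu (lprod A b c))
      - pext (\<lambda>x. psub t (lam + mu) (\<omega> x c)) (psub s lam (lprod A a b))
      + pext (\<lambda>x. psub t (lam + mu) (\<omega> x c)) (psub s mu (lprod A b a)) = 0)"

definition invariant_cocycle ::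
  "'a::ab_group_add conf_alg \<Rightarrow> ('a \<Rightarrow> 'a \<Rightarrow> ('a \<Rightarrow> complex poly) poly) \<Rightarrow> bool" where
  "invariant_cocycle A \<omega> \<longleftrightarrow> two_cocycle A \<omega> \<and>
     (let t = csc (cdual A) in
      \<forall>a\<in>carr A. \<forall>b\<in>carr A. \<forall>c\<in>carr A.
        pext (\<lambda>f. psub (*) (lam + mu) (f c)) (psub t lam (\<omega> a b))
      - pext (\<lambda>f. psub (*) (- lam) (f a)) (psub t mu (\<omega> b c))
      = pext (\<lambda>f. psub (*) (lam + mu) (f c)) (psub t mu (\<omega> b a))
      - pext (\<lambda>f. psub (*) (- mu) (f b)) (psub t lam (\<omega> a c)))"


section \<open>Conformal bilinear forms\<close>

definition conf_form ::
  "('a::ab_group_add, 'z) conf_mod_scheme \<Rightarrow> ('a \<Rightarrow> 'a \<Rightarrow> complex poly) \<Rightarrow> bool" where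
  "conf_form V \<beta> \<longleftrightarrow> bilinear_on V smult \<beta> \<and>
     (\<forall>a\<in>carr V. \<forall>b\<in>carr V. \<beta> (der V a) b = - ([:0, 1:] * \<beta> a b)) \<and>
     (\<forall>a\<in>carr V. \<forall>b\<in>carr V. \<beta> a (der V b) = [:0, 1:] * \<beta> a b)"

definition symmetric_form ::
  "('a::ab_group_add, 'z) conf_mod_scheme \<Rightarrow> ('a \<Rightarrow> 'a \<Rightarrow> complex poly) \<Rightarrow> bool" where
  "symmetric_form V \<beta> \<longleftrightarrow> (\<forall>a\<in>carr V. \<forall>b\<in>carr V. \<beta> a b = pneg (\<beta> b a))"

definition invariant_form ::
  "'a::ab_group_add conf_alg \<Rightarrow> ('a \<Rightarrow> 'a \<Rightarrow> complex poly) \<Rightarrow> bool" where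
  "invariant_form A \<beta> \<longleftrightarrow>
     (\<forall>a\<in>carr A. \<forall>b\<in>carr A. \<forall>c\<in>carr A.
        pext (\<lambda>x. psub (*) (lam + mu) (\<beta> x c)) (psub (csc A) lam (lprod A a b))
      - pext (\<lambda>x. psub (*) lam (\<beta> a x)) (psub (csc A) mu (lprod A b c))
      = pext (\<lambda>x. psub (*) (lam + mu) (\<beta> x c)) (psub (csc A) mu (lprod A b a))
      - pext (\<lambda>x. psub (*) mu (\<beta> b x)) (psub (csc A) lam (lprod A a c)))"

definition form_of :: "('a \<Rightarrow> 'a \<Rightarrow> complex poly) \<Rightarrow> 'a \<Rightarrow> 'a \<Rightarrow> complex poly" where
  "form_of \<theta> a b = smult (1 / 2) (\<theta> a b + pneg (\<theta> b a))"


section \<open>T*-extensions\<close>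

definition text_alg ::
  "'a::ab_group_add conf_alg \<Rightarrow> ('a \<Rightarrow> 'a \<Rightarrow> ('a \<Rightarrow> complex poly) poly)
     \<Rightarrow> ('a \<times> ('a \<Rightarrow> complex poly)) conf_alg" where
  "text_alg A \<omega> =
     \<lparr>carr = carr A \<times> carr (cdual A),
      act = (\<lambda>p (a, f). (act A p a, act (cdual A) p f)),
      lprod = (\<lambda>(a, f) (b, g).
        map_poly (\<lambda>x. (x, 0)) (lprod A a b) + map_poly (\<lambda>h. (0, h)) (\<omega> a b + lstar A a g))\<rparr>"

definition text_form ::
  "'a \<times> ('a \<Rightarrow> complex poly) \<Rightarrow> 'a \<times> ('a \<Rightarrow> complex poly) \<Rightarrow> complex poly" where
  "text_form = (\<lambda>(a, f) (b, g). f b + pneg (g a))"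

definition text_equivalence ::
  "'a::ab_group_add conf_alg \<Rightarrow> ('a \<Rightarrow> 'a \<Rightarrow> ('a \<Rightarrow> complex poly) poly)
     \<Rightarrow> ('a \<Rightarrow> 'a \<Rightarrow> ('a \<Rightarrow> complex poly) poly)
     \<Rightarrow> ('a \<times> ('a \<Rightarrow> complex poly) \<Rightarrow> 'a \<times> ('a \<Rightarrow> complex poly)) \<Rightarrow> bool" where
  "text_equivalence A \<omega>1 \<omega>2 \<Phi> \<longleftrightarrow> lsca_iso (text_alg A \<omega>1) (text_alg A \<omega>2) \<Phi> \<and>
     (\<forall>f\<in>carr (cdual A). \<Phi> (0, f) = (0, f)) \<and>
     (\<forall>a\<in>carr A. \<Phi> (a, 0) - (a, 0) \<in> {0} \<times> carr (cdual A))"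

definition text_equivalent ::
  "'a::ab_group_add conf_alg \<Rightarrow> ('a \<Rightarrow> 'a \<Rightarrow> ('a \<Rightarrow> complex poly) poly)
     \<Rightarrow> ('a \<Rightarrow> 'a \<Rightarrow> ('a \<Rightarrow> complex poly) poly) \<Rightarrow> bool" where
  "text_equivalent A \<omega>1 \<omega>2 \<longleftrightarrow> (\<exists>\<Phi>. text_equivalence A \<omega>1 \<omega>2 \<Phi>)"

definition text_isometrically_equivalent ::
  "'a::ab_group_add conf_alg \<Rightarrow> ('a \<Rightarrow> 'a \<Rightarrow> ('a \<Rightarrow> complex poly) poly)
     \<Rightarrow> ('a \<Rightarrow> 'a \<Rightarrow> ('a \<Rightarrow> complex poly) poly) \<Rightarrow> bool" where
  "text_isometrically_equivalent A \<omega>1 \<omega>2 \<longleftrightarrow>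
     (\<exists>\<Phi>. text_equivalence A \<omega>1 \<omega>2 \<Phi> \<and>
        (\<forall>x\<in>carr (text_alg A \<omega>1). \<forall>y\<in>carr (text_alg A \<omega>1).
           text_form (\<Phi> x) (\<Phi> y) = text_form x y))"


section \<open>Well-definedness of the dual left action\<close>

text \<open>
  Existence uses finite generation: it bounds the degree in lambda uniformly in the argument of
  the functional.
\<close>

definition ev2 :: "complex poly poly \<Rightarrow> complex \<Rightarrow> complex \<Rightarrow> complex" where
  "ev2 Q l m = poly (poly Q [:l:]) m"

lemma ev2_zero_imp: assumes "\<And>l m. ev2 Q l m = 0" shows "Q = 0"
proof (rule ccontr)
  assume "Q \<noteq> 0"
  then have "finite {x. poly Q x = 0}" by (rule poly_roots_finite)
  moreover have "range (\<lambda>l::complex. [:l:]) \<subseteq> {x. poly Q x = 0}"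
    using assms unfolding ev2_def by (auto simp: poly_eq_poly_eq_iff[symmetric])
  ultimately have "finite (range (\<lambda>l::complex. [:l:]))" by (rule rev_finite_subset)
  moreover have "inj (\<lambda>l::complex. [:l:])" by (auto simp: inj_def)
  ultimately have "finite (UNIV :: complex set)" using finite_imageD by blast
  then show False using infinite_UNIV_char_0 by blast
qed

lemma ev2_add: "ev2 (P + Q) l m = ev2 P l m + ev2 Q l m" by (simp add: ev2_def)
lemma ev2_minus: "ev2 (- P) l m = - ev2 P l m" by (simp add: ev2_def)
lemma ev2_diff: "ev2 (P - Q) l m = ev2 P l m - ev2 Q l m" by (simp add: ev2_def)
lemma ev2_mult: "ev2 (P * Q) l m = ev2 P l m * ev2 Q l m" by (simp add: ev2_def)
lemma ev2_power: "ev2 (P ^ n) l m = ev2 P l m ^ n" by (simp add: ev2_def)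
lemma ev2_sum: "ev2 (sum f S) l m = (\<Sum>i\<in>S. ev2 (f i) l m)" by (simp add: ev2_def poly_sum)
lemma ev2_lam: "ev2 lam l m = l" by (simp add: ev2_def lam_def)
lemma ev2_mu: "ev2 mu l m = m" by (simp add: ev2_def mu_def)
lemma ev2_smult: "ev2 (smult p Q) l m = poly p m * ev2 Q l m" by (simp add: ev2_def)

lemmas ev2_simps = ev2_add ev2_minus ev2_diff ev2_mult ev2_power ev2_sum ev2_lam ev2_mu ev2_smult

lemma ev2_eqI: assumes "\<And>l m. ev2 P l m = ev2 Q l m" shows "P = Q"
  using ev2_zero_imp[of "P - Q"] assms by (simp add: ev2_diff)

lemma ev2_psub: "ev2 (psub (*) r p) l m = poly p (ev2 r l m)"
proof -
  have *: "map_poly (map_poly (\<lambda>c. c * x)) q = smult [:x:] q" for x :: complex and q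
    by (intro poly_eqI) (simp add: coeff_map_poly mult.commute)
  show ?thesis
    by (simp add: psub_def * ev2_simps poly_altdef)
qed

lemma pCons_pow: "(pCons 0 ^^ i) Q = monom 1 i * (Q::'a::comm_semiring_1 poly)"
  by (induction i) (simp_all add: monom_Suc)

lemma psub_lam:
  assumes "\<And>x. s 0 x = 0" "\<And>x. s 1 x = x"
  shows "psub s lam p = map_poly (\<lambda>x. [:x:]) p"
proof -
  have l: "lam ^ n = monom 1 n" for n unfolding lam_def by (metis monom_altdef smult_1_left)
  have *: "map_poly (map_poly (\<lambda>c. s c x)) (lam ^ n) = monom [:x:] n" for x n
    by (intro poly_eqI) (auto simp: l coeff_map_poly assms one_pCons coeff_pCons split: nat.splits)
  show ?thesis unfolding psub_def *
    by (intro poly_eqI) (auto simp: coeff_sum coeff_map_poly coeff_eq_0)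
qed

lemma psub_mu:
  assumes "\<And>x. s 0 x = 0" "\<And>x. s 1 x = x"
  shows "psub s mu p = [:p:]"
proof -
  have l: "mu ^ n = [:monom 1 n:]" for n
    by (induction n) (simp_all add: mu_def one_pCons monom_Suc monom_0)
  have *: "map_poly (map_poly (\<lambda>c. s c x)) (mu ^ n) = [:monom x n:]" for x n
    by (simp add: l map_poly_pCons map_poly_monom assms)
  show ?thesis unfolding psub_def *
    by (intro poly_eqI) (auto simp: coeff_sum coeff_pCons coeff_eq_0 split: nat.splits)
qed

lemma ev2_pext_lam:
  fixes h :: "'a::zero \<Rightarrow> complex poly poly" and p :: "'a poly"
  assumes "h 0 = 0" "degree p \<le> N"
  shows "ev2 (pext h (map_poly (\<lambda>x. [:x:]) p)) l m = (\<Sum>i\<le>N. l ^ i * ev2 (h (coeff p i)) l m)"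
proof -
  have id: "map_poly ((pCons 0 ^^ 0)::complex poly \<Rightarrow> _) = (\<lambda>Q. Q)"
    by (auto simp: fun_eq_iff poly_eq_iff coeff_map_poly)
  have d: "degree (map_poly (\<lambda>x. [:x:]) p) = degree p"
    by (rule degree_map_poly) simp
  have "ev2 (pext h (map_poly (\<lambda>x. [:x:]) p)) l m
      = (\<Sum>i\<le>degree p. l ^ i * ev2 (h (coeff p i)) l m)"
    using id by (simp add: pext_def d coeff_map_poly ev2_sum pCons_pow ev2_mult)
      (simp add: ev2_def poly_monom)
  also have "\<dots> = (\<Sum>i\<le>N. l ^ i * ev2 (h (coeff p i)) l m)"
    using assms by (intro sum.mono_neutral_left) (auto simp: coeff_eq_0 ev2_def)
  finally show ?thesis .
qed


lemma lsca_facts: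
  assumes "lsca A"
  shows "module (act A)" "\<And>p x. x \<in> carr A \<Longrightarrow> act A p x \<in> carr A"
    "\<And>x y. x \<in> carr A \<Longrightarrow> y \<in> carr A \<Longrightarrow> x + y \<in> carr A" "0 \<in> carr A"
    "\<And>x. csc A 0 x = 0" "\<And>x. csc A 1 x = x"
    "\<And>a b n. a \<in> carr A \<Longrightarrow> b \<in> carr A \<Longrightarrow> coeff (lprod A a b) n \<in> carr A"
proof -
  show m: "module (act A)" using assms by (simp add: lsca_def is_conf_mod_def)
  have s: "module.subspace (act A) (carr A)" using assms by (simp add: lsca_def is_conf_mod_def)
  show "\<And>p x. x \<in> carr A \<Longrightarrow> act A p x \<in> carr A" 
    "\<And>x y. x \<in> carr A \<Longrightarrow> y \<in> carr A \<Longrightarrow> x + y \<in> carr A" "0 \<in> carr A"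
    using s module.subspace_def[OF m] by auto
  show "\<And>x. csc A 0 x = 0" "\<And>x. csc A 1 x = x"
    unfolding csc_def using module.scale_zero_left[OF m] module.scale_one[OF m]
    by (auto simp: one_pCons[symmetric])
  show "\<And>a b n. a \<in> carr A \<Longrightarrow> b \<in> carr A \<Longrightarrow> coeff (lprod A a b) n \<in> carr A"
    using assms by (auto simp: lsca_def conf_sesquilinear_def polys_def)
qed

lemma cdual_csc: "csc (cdual A) 0 f = 0" "csc (cdual A) 1 f = f"
  by (auto simp: csc_def cdual_def pneg_def fun_eq_iff pcompose_pCons)

lemma cdual_zero:
  assumes "f \<in> carr (cdual A)" "lsca A" shows "f 0 = 0"
proof -
  have "\<forall>x\<in>carr A. \<forall>y\<in>carr A. f (x + y) = f x + f y"
    using assms(1) by (simp add: cdual_def linear_on_def)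
  from this[rule_format, OF lsca_facts(4)[OF assms(2)] lsca_facts(4)[OF assms(2)]]
  have "f (0 + 0) = f 0 + f 0" .
  then show ?thesis by simp
qed

lemma is_lstar_iff:
  assumes "lsca A" "a \<in> carr A" "f \<in> carr (cdual A)"
  shows "is_lstar A a f P \<longleftrightarrow> P \<in> polys (cdual A) \<and>
    (\<forall>b\<in>carr A. \<forall>l m. (\<Sum>i\<le>degree P. l ^ i * poly (coeff P i b) (l + m))
       = - (\<Sum>i\<le>degree (lprod A a b). l ^ i * poly (f (coeff (lprod A a b) i)) m))"
proof -
  have f0: "f 0 = 0" using cdual_zero[OF assms(3,1)] .
  have z: "psub (*) r 0 = 0" for r :: "complex poly poly"
    by (simp add: psub_def poly_eq_iff coeff_map_poly)
  have 1: "ev2 (pext (\<lambda>g. psub (*) (lam + mu) (g b)) (psub (csc (cdual A)) lam P)) l m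
     = (\<Sum>i\<le>degree P. l ^ i * poly (coeff P i b) (l + m))" for b l m
    by (subst psub_lam, simp add: cdual_csc, simp add: cdual_csc,
       subst ev2_pext_lam[where N="degree P"]) (simp_all add: ev2_psub z ev2_simps)
  have 2: "ev2 (- pext (\<lambda>x. psub (*) mu (f x)) (psub (csc A) lam (lprod A a b))) l m
     = - (\<Sum>i\<le>degree (lprod A a b). l ^ i * poly (f (coeff (lprod A a b) i)) m)" for b l m
    unfolding ev2_minus
    by (subst psub_lam, simp add: lsca_facts[OF assms(1)], simp add: lsca_facts[OF assms(1)],
       subst ev2_pext_lam[where N="degree (lprod A a b)"]) (simp_all add: ev2_psub z f0 ev2_simps)
  show ?thesis unfolding is_lstar_def 1[symmetric] 2[symmetric]
    by (metis ev2_eqI)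
qed

lemma lstar_unique:
  assumes "lsca A" "a \<in> carr A" "f \<in> carr (cdual A)" "is_lstar A a f P" "is_lstar A a f P'"
  shows "P = P'"
proof -
  have P: "P \<in> polys (cdual A)" "P' \<in> polys (cdual A)" using assms by (auto simp: is_lstar_def)
  define N where "N = max (degree P) (degree P')"
  have dN: "degree P \<le> N" "degree P' \<le> N" by (auto simp: N_def)
  have pad: "(\<Sum>i\<le>degree R. l ^ i * poly (coeff R i b) m)
      = (\<Sum>i\<le>N. l ^ i * poly (coeff R i b) m)"
    if "degree R \<le> N" for R :: "('a \<Rightarrow> complex poly) poly" and l m b
    using that by (intro sum.mono_neutral_left) (auto simp: coeff_eq_0)
  have ev: "ev2 (\<Sum>i\<le>N. monom (coeff R i b) i) l m = (\<Sum>i\<le>N. l ^ i * poly (coeff R i b) m)"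
    for R :: "('a \<Rightarrow> complex poly) poly" and l m b
    by (simp add: ev2_sum) (simp add: ev2_def poly_monom mult.commute)
  have eq: "(\<Sum>i\<le>N. monom (coeff P i b) i) = (\<Sum>i\<le>N. monom (coeff P' i b) i)" if "b \<in> carr A" for b
  proof (rule ev2_eqI)
    fix l m
    show "ev2 (\<Sum>i\<le>N. monom (coeff P i b) i) l m = ev2 (\<Sum>i\<le>N. monom (coeff P' i b) i) l m"
      using assms(4,5)[unfolded is_lstar_iff[OF assms(1-3)], THEN conjunct2, rule_format,
          OF that, of l "m - l"] pad[of P l b m] pad[of P' l b m]
      by (simp add: ev dN)
  qed
  show ?thesis
  proof (rule poly_eqI, rule ext)
    fix n b
    show "coeff P n b = coeff P' n b"
    proof (cases "b \<in> carr A")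
      case True
      show ?thesis using arg_cong[OF eq[OF True], of "\<lambda>Q. coeff Q n"]
        by (cases "n \<le> N") (auto simp: coeff_sum N_def coeff_eq_0)
    next
      case False
      then show ?thesis using P by (auto simp: polys_def cdual_def)
    qed
  qed
qed

lemma lstar_exists:
  assumes A: "lsca A" and fg: "fin_gen A" and a: "a \<in> carr A" and f: "f \<in> carr (cdual A)"
  shows "is_lstar A a f (lstar A a f)"
proof -
  note F = lsca_facts[OF A]
  have f0: "f 0 = 0" using cdual_zero[OF f A] .
  have fadd: "f (x + y) = f x + f y" if "x \<in> carr A" "y \<in> carr A" for x y
    using f that by (auto simp: cdual_def linear_on_def)
  have fsc: "f (csc A c x) = smult c (f x)" if "x \<in> carr A" for x c
    using f that by (auto simp: cdual_def linear_on_def)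
  have fder: "f (der A x) = [:0, 1:] * f x" if "x \<in> carr A" for x
    using f that by (auto simp: cdual_def)
  have ladd: "lprod A a (x + y) = lprod A a x + lprod A a y" if "x \<in> carr A" "y \<in> carr A" for x y
    using A a that by (auto simp: lsca_def conf_sesquilinear_def bilinear_on_def linear_on_def)
  have lsc: "lprod A a (csc A c x) = map_poly (csc A c) (lprod A a x)" if "x \<in> carr A" for x c
    using A a that by (auto simp: lsca_def conf_sesquilinear_def bilinear_on_def linear_on_def)
  have lder: "lprod A a (der A x) = map_poly (der A) (lprod A a x) + pCons 0 (lprod A a x)"
    if "x \<in> carr A" for x
    using A a that by (auto simp: lsca_def conf_sesquilinear_def)
  have csc0: "csc A c 0 = 0" and der0: "der A 0 = 0" for c
    using module.scale_zero_right[OF F(1)] by (auto simp: csc_def der_def)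
  define Q where "Q b = - (\<Sum>i\<le>degree (lprod A a b).
      lam ^ i * psub (*) (mu - lam) (f (coeff (lprod A a b) i)))" for b
  have Qev: "ev2 (Q b) l m = - (\<Sum>i\<le>N. l ^ i * poly (f (coeff (lprod A a b) i)) (m - l))"
    if "degree (lprod A a b) \<le> N" for b l m N
  proof -
    have "ev2 (Q b) l m = - (\<Sum>i\<le>degree (lprod A a b). l ^ i * poly (f (coeff (lprod A a b) i)) (m - l))"
      by (simp add: Q_def ev2_simps ev2_psub)
    also have "\<dots> = - (\<Sum>i\<le>N. l ^ i * poly (f (coeff (lprod A a b) i)) (m - l))"
      using that f0 by (intro arg_cong[where f=uminus] sum.mono_neutral_left) (auto simp: coeff_eq_0)
    finally show ?thesis .
  qed
  have Qadd: "Q (x + y) = Q x + Q y" if "x \<in> carr A" "y \<in> carr A" for x y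
  proof (rule ev2_eqI)
    fix l m
    define N where "N = Max {degree (lprod A a x), degree (lprod A a y), degree (lprod A a (x+y))}"
    have N: "degree (lprod A a x) \<le> N" "degree (lprod A a y) \<le> N" "degree (lprod A a (x+y)) \<le> N"
      by (auto simp: N_def)
    show "ev2 (Q (x + y)) l m = ev2 (Q x + Q y) l m"
      using that F(7)[OF a]
      by (simp add: ev2_add Qev[OF N(1)] Qev[OF N(2)] Qev[OF N(3)] ladd fadd algebra_simps sum.distrib)
  qed
  have Qsc: "Q (csc A c x) = smult [:c:] (Q x)" if "x \<in> carr A" for x c
  proof (rule ev2_eqI)
    fix l m
    define N where "N = Max {degree (lprod A a x), degree (lprod A a (csc A c x))}"
    have N: "degree (lprod A a x) \<le> N" "degree (lprod A a (csc A c x)) \<le> N"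
      by (auto simp: N_def)
    show "ev2 (Q (csc A c x)) l m = ev2 (smult [:c:] (Q x)) l m"
      using that F(7)[OF a]
      by (simp add: ev2_smult Qev[OF N(1)] Qev[OF N(2)] lsc fsc coeff_map_poly csc0
          sum_distrib_left mult.left_commute)
  qed
  have Qder: "Q (der A x) = smult [:0, 1:] (Q x)" if x: "x \<in> carr A" for x
  proof (rule ev2_eqI)
    fix l m
    define N where "N = Max {degree (lprod A a x), degree (lprod A a (der A x))}"
    have N: "degree (lprod A a x) \<le> N" "degree (lprod A a (der A x)) \<le> Suc N"
       "degree (lprod A a x) \<le> Suc N"
      by (auto simp: N_def)
    let ?c = "\<lambda>i. coeff (lprod A a x) i"
    let ?g = "\<lambda>i. poly (f (?c i)) (m - l)"
    have c: "?c i \<in> carr A" for i using F(7)[OF a x] .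
    have dc: "der A (?c i) \<in> carr A" for i using F(2)[OF c] by (simp add: der_def)
    have pc: "coeff (pCons 0 (lprod A a x)) i \<in> carr A" for i
      using c F(4) by (auto simp: coeff_pCons split: nat.splits)
    have t: "poly (f (coeff (lprod A a (der A x)) i)) (m - l)
       = (m - l) * ?g i + (case i of 0 \<Rightarrow> 0 | Suc j \<Rightarrow> ?g j)" for i
      using x by (simp add: lder coeff_map_poly der0 fadd[OF dc pc] fder[OF c])
        (simp add: coeff_pCons f0 split: nat.splits)
    have "(\<Sum>i\<le>Suc N. l ^ i * poly (f (coeff (lprod A a (der A x)) i)) (m - l))
       = (m - l) * (\<Sum>i\<le>Suc N. l ^ i * ?g i)
         + (\<Sum>i\<le>Suc N. l ^ i * (case i of 0 \<Rightarrow> 0 | Suc j \<Rightarrow> ?g j))"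
      by (simp add: t algebra_simps sum.distrib sum_subtractf sum_distrib_left del: sum.atMost_Suc)
    also have "(\<Sum>i\<le>Suc N. l ^ i * (case i of 0 \<Rightarrow> 0 | Suc j \<Rightarrow> ?g j)) = l * (\<Sum>i\<le>N. l ^ i * ?g i)"
      by (subst sum.atMost_Suc_shift) (simp add: sum_distrib_left mult.assoc)
    also have "(\<Sum>i\<le>Suc N. l ^ i * ?g i) = (\<Sum>i\<le>N. l ^ i * ?g i)"
      using N(1) f0 by (simp add: coeff_eq_0)
    finally show "ev2 (Q (der A x)) l m = ev2 (smult [:0, 1:] (Q x)) l m"
      by (simp add: ev2_smult Qev[OF N(1)] Qev[OF N(2)] algebra_simps del: sum.atMost_Suc)
  qed
  have Qact: "Q (act A p x) = smult p (Q x)" if x: "x \<in> carr A" for x p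
  proof (induction p)
    case 0
    then show ?case using Qadd[OF F(4) F(4)] module.scale_zero_left[OF F(1)] by simp
  next
    case (pCons c p)
    have "act A (pCons c p) x = act A ([:c:] + [:0,1:] * p) x" by simp
    also have "\<dots> = csc A c x + der A (act A p x)"
      unfolding module.scale_left_distrib[OF F(1)] module.scale_scale[OF F(1), symmetric]
      by (simp add: csc_def der_def)
    finally have "Q (act A (pCons c p) x) = smult [:c:] (Q x) + smult [:0,1:] (Q (act A p x))"
      using x F(2)[OF x] F(2)[OF F(2)[OF x]] Qder Qsc Qadd by (simp add: csc_def der_def)
    also have "\<dots> = smult ([:c:] + [:0,1:] * p) (Q x)"
      by (simp only: pCons.IH smult_add_left smult_smult)
    finally show ?case by simp
  qed
  obtain S where S: "finite S" "module.span (act A) S = carr A" using fg by (auto simp: fin_gen_def)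
  define N where "N = Max (insert 0 ((\<lambda>s. degree (Q s)) ` S))"
  have NS: "degree (Q s) \<le> N" if "s \<in> S" for s using that S(1) by (auto simp: N_def)
  have SA: "S \<subseteq> carr A" using module.span_superset[OF F(1)] S(2) by auto
  have deg: "b \<in> carr A \<and> degree (Q b) \<le> N" if "b \<in> carr A" for b
  proof -
    have "b \<in> module.span (act A) S" using that S by simp
    moreover have "module.subspace (act A) {b \<in> carr A. degree (Q b) \<le> N}"
      unfolding module.subspace_def[OF F(1)]
      using F Qadd[OF F(4) F(4)] 
      by (auto simp: Qadd Qact intro: degree_add_le le_trans[OF degree_smult_le])
    ultimately show ?thesis
      using module.span_minimal[OF F(1), of S "{b \<in> carr A. degree (Q b) \<le> N}"] SA NS by auto
  qed
  define P where "P = (\<Sum>n\<le>N. monom (\<lambda>b. if b \<in> carr A then coeff (Q b) n else 0) n)"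
  have cP: "coeff P n = (\<lambda>b. if b \<in> carr A then coeff (Q b) n else 0)" for n
  proof (cases "n \<le> N")
    case False
    then have "coeff (Q b) n = 0" if "b \<in> carr A" for b
      using deg[OF that] by (intro coeff_eq_0) auto
    then show ?thesis using False by (auto simp: P_def coeff_sum fun_eq_iff)
  qed (simp add: P_def coeff_sum)
  have dP: "degree P \<le> N" unfolding P_def
    by (intro degree_sum_le) (auto intro: le_trans[OF degree_monom_le])
  have "is_lstar A a f P"
    unfolding is_lstar_iff[OF A a f]
  proof (intro conjI ballI allI)
    show "P \<in> polys (cdual A)"
      using F(2,3) by (auto simp: polys_def cP cdual_def linear_on_def Qadd)
        (auto simp: Qsc csc_def der_def Qder[unfolded der_def] Qsc[unfolded csc_def])
  next
    fix b l m assume b: "b \<in> carr A"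
    have "(\<Sum>i\<le>degree P. l ^ i * poly (coeff P i b) (l + m))
       = (\<Sum>i\<le>N. l ^ i * poly (coeff P i b) (l + m))"
      using dP by (intro sum.mono_neutral_left) (auto simp: coeff_eq_0)
    also have "\<dots> = ev2 (\<Sum>i\<le>N. monom (coeff (Q b) i) i) l (l + m)"
      using b by (simp add: ev2_sum cP) (simp add: ev2_def poly_monom mult.commute)
    also have "(\<Sum>i\<le>N. monom (coeff (Q b) i) i) = Q b"
      using deg[OF b] by (intro poly_eqI) (auto simp: coeff_sum coeff_eq_0)
    finally show "(\<Sum>i\<le>degree P. l ^ i * poly (coeff P i b) (l + m))
       = - (\<Sum>i\<le>degree (lprod A a b). l ^ i * poly (f (coeff (lprod A a b) i)) m)"
      by (simp add: Qev[OF order_refl])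
  qed
  note P = this
  show ?thesis unfolding lstar_def
    by (rule theI[where P="is_lstar A a f", OF P]) (rule lstar_unique[OF A a f _ P])
qed

end

theory Submission
  imports Defs
begin

text \<open>
  An equivalence over the identity of \<open>A\<close> has the form \<open>(a, f) \<mapsto> (a, f + \<theta> a)\<close>; comparing the dual
  components of the products says that \<open>\<omega>1 - \<omega>2\<close> is the coboundary of \<open>\<theta>\<close>, and the defect of the
  map from being an isometry is twice the form induced by \<open>\<theta>\<close>.  Invariance of that form is the
  invariance condition for the cocycle \<open>\<omega>1 - \<omega>2\<close>, rewritten by means of the formula for the
  coboundary.  Identities between polynomials in lambda and mu are checked on complex numbers.
\<close>

section \<open>Evaluation of polynomials in lambda and mu at complex numbers\<close>

text \<open>Applying \<open>\<phi>\<close> may kill the leading coefficient and lower the degree.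
  Summing up to the degree of \<open>p\<close> only adds zero terms and matches the range of the
  sums that arise from \<open>pext\<close>.\<close>

lemma poly_map_poly_eq_sum:
  fixes \<phi> :: "'a::zero \<Rightarrow> 'b::comm_semiring_1"
  assumes "\<phi> 0 = 0"
  shows "poly (map_poly \<phi> p) x = (\<Sum>i\<le>degree p. x ^ i * \<phi> (coeff p i))"
proof -
  have "degree (map_poly \<phi> p) \<le> degree p"
    by (rule degree_le) (simp add: coeff_map_poly assms coeff_eq_0)
  then have "poly (map_poly \<phi> p) x = (\<Sum>i\<le>degree p. coeff (map_poly \<phi> p) i * x ^ i)"
    unfolding poly_altdef by (intro sum.mono_neutral_left) (auto simp: coeff_eq_0)
  then show ?thesis by (simp add: coeff_map_poly assms mult.commute)
qed

text \<open>Every double product, nested action or nested form is encoded as such a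
  \<open>pext\<close> term. This rule and its companion for \<open>mu\<close> reduce an identity
  between them to one between values of polynomials in one variable: the coefficients are evaluated
  at the value of \<open>r\<close>, the result at the value of the outer variable.\<close>

lemma ev2_pext_psub_lam:
  assumes "\<And>x. s 0 x = 0" "\<And>x. s 1 x = x" "H 0 = 0"
  shows "ev2 (pext (\<lambda>x. psub (*) r (H x)) (psub s lam p)) l m
    = poly (map_poly (\<lambda>x. poly (H x) (ev2 r l m)) p) l"
proof -
  have "psub (*) r (0 :: complex poly) = 0"
    by (simp add: psub_def poly_eq_iff coeff_map_poly)
  then show ?thesis
    by (simp add: psub_lam assms ev2_pext_lam[where N = "degree p"] ev2_psub poly_map_poly_eq_sum)
qed

lemma ev2_pext_psub_mu:
  assumes "\<And>x. s 0 x = 0" "\<And>x. s 1 x = x" "H 0 = 0"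
  shows "ev2 (pext (\<lambda>x. psub (*) r (H x)) (psub s mu p)) l m
    = poly (map_poly (\<lambda>x. poly (H x) (ev2 r l m)) p) m"
proof -
  \<comment> \<open>After substituting \<open>mu\<close>, the polynomial \<open>p\<close> sits in
    the inner variable, where a shift by \<open>j\<close> is multiplication by the
    \<open>j\<close>-th power of mu.\<close>
  have "map_poly (pCons 0 ^^ j) Q = smult (monom 1 j) Q" for j and Q :: "complex poly poly"
    by (intro poly_eqI) (simp add: coeff_map_poly pCons_pow)
  then show ?thesis
    by (simp add: psub_mu assms pext_def ev2_simps ev2_psub poly_monom poly_map_poly_eq_sum)
qed

lemma map_poly_apply_diff:
  fixes P Q :: "('a \<Rightarrow> complex poly) poly"
  shows "map_poly (\<lambda>f. poly (f b) n) (P - Q)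
    = map_poly (\<lambda>f. poly (f b) n) P - map_poly (\<lambda>f. poly (f b) n) Q"
  by (intro poly_eqI) (simp add: coeff_map_poly)

section \<open>The conformal dual and the sign substitution\<close>

lemma cdual_add: "f + g \<in> carr (cdual V)" if "f \<in> carr (cdual V)" "g \<in> carr (cdual V)"
  using that by (auto simp: cdual_def linear_on_def smult_add_right algebra_simps)

lemma cdual_diff: "f - g \<in> carr (cdual V)" if "f \<in> carr (cdual V)" "g \<in> carr (cdual V)"
  using that by (auto simp: cdual_def linear_on_def smult_diff_right algebra_simps)

lemma zero_in_cdual: "0 \<in> carr (cdual V)"
  by (auto simp: cdual_def linear_on_def)

text \<open>Substituting minus the variable is an involutive algebra automorphism. As rewrite rules
  these push \<open>pneg\<close> inwards and cancel it.\<close>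

lemma pneg_simps [simp]:
  "pneg 0 = 0" "pneg (p + q) = pneg p + pneg q" "pneg (- p) = - pneg p"
  "pneg (p * q) = pneg p * pneg q" "pneg (smult c p) = smult c (pneg p)"
  "pneg (pCons 0 p) = - pCons 0 (pneg p)" "pneg [:c:] = [:c:]" "pneg (pneg p) = p"
  by (simp_all add: pneg_def pcompose_add pcompose_uminus pcompose_mult pcompose_smult
      pcompose_pCons pcompose_assoc[symmetric])

lemma poly_pneg: "poly (pneg p) x = poly p (- x)"
  by (simp add: pneg_def poly_pcompose)

section \<open>The dual left action and coboundaries\<close>

text \<open>The defining identity evaluates the functionals in \<open>P\<close> at lambda + mu.
  Taking this sum as a new free variable \<open>n\<close> expresses the value of \<open>P\<close> at
  any pair \<open>l\<close>, \<open>n\<close>, with mu replaced by \<open>n - l\<close> on the other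
  side.\<close>

lemma is_lstar_iff_poly:
  assumes "lsca A" "a \<in> carr A" "f \<in> carr (cdual A)"
  shows "is_lstar A a f P \<longleftrightarrow> P \<in> polys (cdual A) \<and>
    (\<forall>b\<in>carr A. \<forall>l n. poly (map_poly (\<lambda>g. poly (g b) n) P) l
       = - poly (map_poly (\<lambda>x. poly (f x) (n - l)) (lprod A a b)) l)"
proof -
  note F = lsca_facts[OF assms(1)]
  have f0: "f 0 = 0" using cdual_zero[OF assms(3,1)] .
  have *: "(pext (\<lambda>g. psub (*) (lam + mu) (g b)) (psub (csc (cdual A)) lam P)
      = - pext (\<lambda>x. psub (*) mu (f x)) (psub (csc A) lam (lprod A a b)))
    \<longleftrightarrow> (\<forall>l m. poly (map_poly (\<lambda>g. poly (g b) (l + m)) P) l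
       = - poly (map_poly (\<lambda>x. poly (f x) m) (lprod A a b)) l)"
    (is "?L = ?R \<longleftrightarrow> _") for b
  proof -
    have "?L = ?R \<longleftrightarrow> (\<forall>l m. ev2 ?L l m = ev2 ?R l m)"
      using ev2_eqI by metis
    then show ?thesis
      by (simp add: ev2_pext_psub_lam cdual_csc F(5,6) f0 ev2_simps)
  qed
  \<comment> \<open>The change of variable is the bijection sending \<open>(l, m)\<close> to
    \<open>(l, l + m)\<close>.\<close>
  have shift: "(\<forall>l m. p l (l + m) = q l m) \<longleftrightarrow> (\<forall>l n. p l n = q l (n - l))"
    for p q :: "complex \<Rightarrow> complex \<Rightarrow> complex"
    by (metis add_diff_cancel_left' add.commute diff_add_cancel)
  with * show ?thesis
    unfolding is_lstar_def
    using shift[of "\<lambda>l n. poly (map_poly (\<lambda>g. poly (g b) n) P) l"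
        "\<lambda>l m. - poly (map_poly (\<lambda>x. poly (f x) m) (lprod A a b)) l" for b] by simp
qed

lemma lstar_eqI:
  assumes "lsca A" "a \<in> carr A" "f \<in> carr (cdual A)" "is_lstar A a f P"
  shows "lstar A a f = P"
  unfolding lstar_def using assms lstar_unique by blast

text \<open>The characterising identity is additive jointly in the functional and in
  \<open>P\<close>, so the sum of the two actions satisfies it for \<open>f + g\<close>, and
  uniqueness identifies it. Finite generation enters through the existence of both actions.\<close>

lemma lstar_add:
  assumes "lsca A" "fin_gen A" "a \<in> carr A" "f \<in> carr (cdual A)" "g \<in> carr (cdual A)"
  shows "lstar A a (f + g) = lstar A a f + lstar A a g"
proof (rule lstar_eqI)
  note f = lstar_exists[OF assms(1-4), unfolded is_lstar_iff_poly[OF assms(1,3,4)]]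
  note g = lstar_exists[OF assms(1-3,5), unfolded is_lstar_iff_poly[OF assms(1,3,5)]]
  have f0: "f 0 = 0" "g 0 = 0" using cdual_zero assms by auto
  show fg: "f + g \<in> carr (cdual A)" using assms cdual_add by blast
  have "map_poly (\<lambda>h. poly (h b) n) (P + Q)
    = map_poly (\<lambda>h. poly (h b) n) P + map_poly (\<lambda>h. poly (h b) n) Q"
    for b :: 'a and n and P Q :: "('a \<Rightarrow> complex poly) poly"
    by (intro poly_eqI) (simp add: coeff_map_poly)
  moreover have "map_poly (\<lambda>x. poly ((f + g) x) n) p
    = map_poly (\<lambda>x. poly (f x) n) p + map_poly (\<lambda>x. poly (g x) n) p" for n p
    by (intro poly_eqI) (simp add: coeff_map_poly f0)
  ultimately show "is_lstar A a (f + g) (lstar A a f + lstar A a g)"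
    using f g unfolding is_lstar_iff_poly[OF assms(1,3) fg]
    by (auto simp: polys_def simp del: plus_fun_apply intro: cdual_add)
qed fact+

lemma lstar_zero:
  assumes "lsca A" "fin_gen A" "a \<in> carr A"
  shows "lstar A a 0 = 0"
  using lstar_add[OF assms zero_in_cdual zero_in_cdual] by simp

lemma C1_zero:
  assumes "lsca A" "\<theta> \<in> C1 A"
  shows "\<theta> 0 = 0"
proof -
  have "\<theta> (0 + 0) = \<theta> 0 + \<theta> 0"
    using assms(2) lsca_facts(4)[OF assms(1)] unfolding C1_def conf_mod_hom_def linear_on_def by blast
  then show ?thesis by simp
qed

text \<open>The characterisation of the dual action turns the first summand of \<open>cobdry\<close>
  into values of \<open>\<theta> b\<close> on the product of \<open>a\<close> and \<open>c\<close>.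
  In the second, \<open>\<theta>\<close> is applied coefficientwise. The coboundary thus becomes an
  expression in \<open>\<theta>\<close> and products of \<open>A\<close> alone.\<close>

lemma cobdry_poly:
  assumes "lsca A" "fin_gen A" "\<theta> \<in> C1 A" "a \<in> carr A" "b \<in> carr A" "c \<in> carr A"
  shows "poly (map_poly (\<lambda>f. poly (f c) n) (cobdry A \<theta> a b)) l
    = - poly (map_poly (\<lambda>x. poly (\<theta> b x) (n - l)) (lprod A a c)) l
      - poly (map_poly (\<lambda>x. poly (\<theta> x c) n) (lprod A a b)) l"
proof -
  have b: "\<theta> b \<in> carr (cdual A)" using assms(3,5) by (auto simp: C1_def conf_mod_hom_def)
  have "map_poly (\<lambda>f. poly (f c) n) (map_poly \<theta> (lprod A a b))
    = map_poly (\<lambda>x. poly (\<theta> x c) n) (lprod A a b)"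
    using C1_zero[OF assms(1,3)] by (subst map_poly_map_poly) (simp_all add: o_def)
  then show ?thesis
    using lstar_exists[OF assms(1,2,4) b] assms(6)
    by (simp add: cobdry_def map_poly_apply_diff is_lstar_iff_poly[OF assms(1,4) b])
qed

section \<open>The bilinear form induced by a 1-cochain\<close>

text \<open>In the first argument, \<open>\<theta>\<close> is a module homomorphism and the
  derivation of the dual multiplies by minus lambda. In the second, each \<open>\<theta> z\<close>
  is a functional and the factor is lambda. The \<open>pneg\<close> in the swapped summand reverses
  the sign, so both summands scale alike.\<close>

lemma conf_form_form_of:
  assumes "lsca A" "\<theta> \<in> C1 A"
  shows "conf_form A (form_of \<theta>)"
proof -
  have h: "\<theta> (x + y) = \<theta> x + \<theta> y" "\<theta> (act A p x) = (\<lambda>z. pneg p * \<theta> x z)"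
    if "x \<in> carr A" "y \<in> carr A" for x y p
    using assms(2) that by (auto simp: C1_def conf_mod_hom_def linear_on_def cdual_def)
  have d: "\<theta> z (x + y) = \<theta> z x + \<theta> z y" "\<theta> z (csc A c x) = smult c (\<theta> z x)"
    "\<theta> z (der A x) = [:0, 1:] * \<theta> z x"
    if "x \<in> carr A" "y \<in> carr A" "z \<in> carr A" for x y z c
    using assms(2) that by (auto simp: C1_def conf_mod_hom_def linear_on_def cdual_def)
  have "\<theta> (csc A c x) z = smult c (\<theta> x z)" "\<theta> (der A x) z = - ([:0, 1:] * \<theta> x z)"
    if "x \<in> carr A" for x z c
    using h(2)[OF that that] by (simp_all add: csc_def der_def)
  then show ?thesis
    by (auto simp: conf_form_def bilinear_on_def linear_on_def form_of_def h(1) d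
        smult_add_right smult_diff_right mult_ac)
qed

lemma symmetric_form_of: "symmetric_form V (form_of \<theta>)"
  by (simp add: symmetric_form_def form_of_def add.commute)

lemma poly_map_form_of_left:
  assumes "\<theta> 0 = 0" "\<theta> c 0 = 0"
  shows "poly (map_poly (\<lambda>x. poly (form_of \<theta> x c) n) p) l
    = (poly (map_poly (\<lambda>x. poly (\<theta> x c) n) p) l
      + poly (map_poly (\<lambda>x. poly (\<theta> c x) (- n)) p) l) / 2"
proof -
  have "map_poly (\<lambda>x. poly (form_of \<theta> x c) n) p
    = smult (1 / 2) (map_poly (\<lambda>x. poly (\<theta> x c) n) p + map_poly (\<lambda>x. poly (\<theta> c x) (- n)) p)"
    by (intro poly_eqI) (simp add: coeff_map_poly form_of_def poly_pneg assms)
  then show ?thesis by simp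
qed

lemma poly_map_form_of_right:
  assumes "\<theta> 0 = 0" "\<theta> c 0 = 0"
  shows "poly (map_poly (\<lambda>x. poly (form_of \<theta> c x) n) p) l
    = (poly (map_poly (\<lambda>x. poly (\<theta> c x) n) p) l
      + poly (map_poly (\<lambda>x. poly (\<theta> x c) (- n)) p) l) / 2"
proof -
  \<comment> \<open>Symmetry reduces this case to the previous one, evaluated at
    \<open>- n\<close>.\<close>
  have "form_of \<theta> c x = pneg (form_of \<theta> x c)" for x
    by (simp add: form_of_def add.commute)
  then show ?thesis
    by (simp add: poly_pneg poly_map_form_of_left assms add.commute)
qed

lemma invariant_cocycle_poly:
  assumes "lsca A" "invariant_cocycle A \<omega>" "a \<in> carr A" "b \<in> carr A" "c \<in> carr A"
  shows "poly (map_poly (\<lambda>f. poly (f c) (l + m)) (\<omega> a b)) l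
      - poly (map_poly (\<lambda>f. poly (f a) (- l)) (\<omega> b c)) m
    = poly (map_poly (\<lambda>f. poly (f c) (l + m)) (\<omega> b a)) m
      - poly (map_poly (\<lambda>f. poly (f b) (- m)) (\<omega> a c)) l"
proof -
  let ?t = "csc (cdual A)"
  have "pext (\<lambda>f. psub (*) (lam + mu) (f c)) (psub ?t lam (\<omega> a b))
      - pext (\<lambda>f. psub (*) (- lam) (f a)) (psub ?t mu (\<omega> b c))
      = pext (\<lambda>f. psub (*) (lam + mu) (f c)) (psub ?t mu (\<omega> b a))
      - pext (\<lambda>f. psub (*) (- mu) (f b)) (psub ?t lam (\<omega> a c))"
    using assms by (auto simp: invariant_cocycle_def Let_def)
  from arg_cong[OF this, of "\<lambda>Q. ev2 Q l m"] show ?thesis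
    by (simp add: ev2_simps ev2_pext_psub_lam ev2_pext_psub_mu cdual_csc)
qed

text \<open>The coboundary formula turns the four terms of the cocycle condition into eight values
  of \<open>\<theta>\<close>. Moving terms across the equation groups them in pairs, each being
  twice a value of the induced form; up to the factor -2 this is the invariance of the form.\<close>

lemma invariant_form_of:
  assumes A: "lsca A" "fin_gen A" and \<theta>: "\<theta> \<in> C1 A"
    and \<omega>: "invariant_cocycle A \<omega>1" "invariant_cocycle A \<omega>2"
    and cob: "\<And>a b. a \<in> carr A \<Longrightarrow> b \<in> carr A \<Longrightarrow> \<omega>1 a b - \<omega>2 a b = cobdry A \<theta> a b"
  shows "invariant_form A (form_of \<theta>)"
  unfolding invariant_form_def
proof (intro ballI ev2_eqI)
  note F = lsca_facts[OF A(1)]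
  fix a b c l m assume abc: "a \<in> carr A" "b \<in> carr A" "c \<in> carr A"
  have z: "\<theta> 0 = 0" "\<theta> x 0 = 0" if "x \<in> carr A" for x
    using C1_zero[OF A(1) \<theta>] cdual_zero[of "\<theta> x" A] A \<theta> that
    by (auto simp: C1_def conf_mod_hom_def)
  have z0: "form_of \<theta> 0 x = 0" "form_of \<theta> x 0 = 0" if "x \<in> carr A" for x
    using z[OF that] by (simp_all add: form_of_def)
  have "poly (map_poly (\<lambda>f. poly (f z) n) (cobdry A \<theta> x y)) t
      = poly (map_poly (\<lambda>f. poly (f z) n) (\<omega>1 x y)) t - poly (map_poly (\<lambda>f. poly (f z) n) (\<omega>2 x y)) t"
    if "x \<in> carr A" "y \<in> carr A" for x y z n t
    using cob[OF that, symmetric] by (simp add: map_poly_apply_diff)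
  note diff = this
  \<comment> \<open>The invariance condition is linear in the cocycle, so subtracting its instances
    for \<open>\<omega>1\<close> and \<open>\<omega>2\<close> gives it for the coboundary.\<close>
  have "poly (map_poly (\<lambda>f. poly (f c) (l + m)) (cobdry A \<theta> a b)) l
      - poly (map_poly (\<lambda>f. poly (f a) (- l)) (cobdry A \<theta> b c)) m
    = poly (map_poly (\<lambda>f. poly (f c) (l + m)) (cobdry A \<theta> b a)) m
      - poly (map_poly (\<lambda>f. poly (f b) (- m)) (cobdry A \<theta> a c)) l"
    using arg_cong2[where f = minus, OF invariant_cocycle_poly[OF A(1) \<omega>(1) abc, of l m]
        invariant_cocycle_poly[OF A(1) \<omega>(2) abc, of l m]]
    unfolding diff[OF abc(1,2)] diff[OF abc(2,3)] diff[OF abc(2,1)] diff[OF abc(1,3)]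
    by (simp add: algebra_simps)
  \<comment> \<open>Values of \<open>\<theta> c\<close> arise at both of these points, from the
    terms taken at \<open>- l\<close> and at \<open>- m\<close>; they must agree syntactically for
    the terms to be collected.\<close>
  moreover have "- m - l = - l - m" by simp
  ultimately show "ev2 (pext (\<lambda>x. psub (*) (lam + mu) (form_of \<theta> x c)) (psub (csc A) lam (lprod A a b))
      - pext (\<lambda>x. psub (*) lam (form_of \<theta> a x)) (psub (csc A) mu (lprod A b c))) l m
    = ev2 (pext (\<lambda>x. psub (*) (lam + mu) (form_of \<theta> x c)) (psub (csc A) mu (lprod A b a))
      - pext (\<lambda>x. psub (*) mu (form_of \<theta> b x)) (psub (csc A) lam (lprod A a c))) l m"
    using abc by (simp add: ev2_simps ev2_pext_psub_lam ev2_pext_psub_mu F(5,6) z0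
        poly_map_form_of_left poly_map_form_of_right z cobdry_poly[OF A \<theta>]
        diff_divide_distrib[symmetric])
      (simp add: algebra_simps, simp add: distrib_left[symmetric] del: distrib_left_numeral)
qed

section \<open>Equivalences of extensions and 1-cochains\<close>

text \<open>The dual part \<open>f\<close> of the left factor is absent on the right because the
  right action on the dual is zero.\<close>

lemma lprod_text_alg:
  "coeff (lprod (text_alg A \<omega>) (a, f) (b, g)) n
    = (coeff (lprod A a b) n, coeff (\<omega> a b + lstar A a g) n)"
  by (simp add: text_alg_def coeff_map_poly zero_prod_def)

definition text_shift ::
  "('a \<Rightarrow> 'a \<Rightarrow> complex poly) \<Rightarrow> 'a \<times> ('a \<Rightarrow> complex poly) \<Rightarrow> 'a \<times> ('a \<Rightarrow> complex poly)" where
  "text_shift \<theta> = (\<lambda>(a, f). (a, f + \<theta> a))"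

text \<open>In the dual component, the product in the source contributes \<open>\<theta>\<close> of
  the product in \<open>A\<close>, while the product of the images contributes the action of
  \<open>a\<close> on \<open>\<theta> b\<close>. Their difference is the coboundary, which
  compensates for replacing \<open>\<omega>1\<close> by \<open>\<omega>2\<close>.\<close>

lemma text_shift_equivalence:
  assumes A: "lsca A" "fin_gen A" and \<theta>: "\<theta> \<in> C1 A"
    and cob: "\<And>a b. a \<in> carr A \<Longrightarrow> b \<in> carr A \<Longrightarrow> \<omega>1 a b - \<omega>2 a b = cobdry A \<theta> a b"
  shows "text_equivalence A \<omega>1 \<omega>2 (text_shift \<theta>)"
proof -
  have \<theta>0: "\<theta> 0 = 0" by (rule C1_zero[OF A(1) \<theta>])
  have \<theta>d: "\<theta> a \<in> carr (cdual A)" if "a \<in> carr A" for a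
    using \<theta> that by (simp add: C1_def conf_mod_hom_def)
  have h: "\<theta> (x + y) = \<theta> x + \<theta> y" "\<theta> (act A p x) = act (cdual A) p (\<theta> x)"
    if "x \<in> carr A" "y \<in> carr A" for x y p
    using \<theta> that by (auto simp: C1_def conf_mod_hom_def linear_on_def)
  have ac: "act (cdual A) p (f + g) = act (cdual A) p f + act (cdual A) p g" for p f g
    by (simp add: cdual_def fun_eq_iff algebra_simps)
  have hom: "conf_mod_hom (text_alg A \<omega>1) (text_alg A \<omega>2) (text_shift \<theta>)"
    by (auto simp: conf_mod_hom_def linear_on_def text_alg_def text_shift_def h ac \<theta>d
        intro: cdual_add)
  have "map_poly (text_shift \<theta>) (lprod (text_alg A \<omega>1) (a, f) (b, g))
      = lprod (text_alg A \<omega>2) (text_shift \<theta> (a, f)) (text_shift \<theta> (b, g))"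
    if ab: "a \<in> carr A" "b \<in> carr A" "g \<in> carr (cdual A)" for a b f g
  proof (rule poly_eqI)
    fix n
    have "\<omega>1 a b = \<omega>2 a b + lstar A a (\<theta> b) - map_poly \<theta> (lprod A a b)"
      using cob[OF ab(1,2)] by (simp add: cobdry_def algebra_simps)
    then show "coeff (map_poly (text_shift \<theta>) (lprod (text_alg A \<omega>1) (a, f) (b, g))) n
      = coeff (lprod (text_alg A \<omega>2) (text_shift \<theta> (a, f)) (text_shift \<theta> (b, g))) n"
      using ab lstar_add[OF A ab(1,3) \<theta>d[OF ab(2)]]
      by (simp add: coeff_map_poly lprod_text_alg text_shift_def zero_prod_def \<theta>0)
  qed
  then have hom2: "lsca_hom (text_alg A \<omega>1) (text_alg A \<omega>2) (text_shift \<theta>)"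
    using hom by (auto simp: lsca_hom_def text_alg_def)
  have "bij_betw (text_shift \<theta>) (carr (text_alg A \<omega>1)) (carr (text_alg A \<omega>2))"
    \<comment> \<open>The inverse is the shift by minus \<open>\<theta>\<close>.\<close>
    by (rule bij_betw_byWitness[where f' = "\<lambda>(a, f). (a, f - \<theta> a)"])
      (auto simp: text_shift_def text_alg_def \<theta>d intro: cdual_add cdual_diff)
  then show ?thesis
    using hom2 by (auto simp: text_equivalence_def lsca_iso_def text_shift_def \<theta>0 \<theta>d)
qed

text \<open>Since \<open>\<Phi>\<close> fixes the dual and is additive, its values on
  \<open>A\<close> determine it on the carrier; the product of two elements of \<open>A\<close> then
  yields the coboundary relation.\<close>

lemma text_equivalenceE:
  assumes A: "lsca A" "fin_gen A"
    and \<omega>: "conf_sesquilinear A (cdual A) \<omega>1"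
    and eq: "text_equivalence A \<omega>1 \<omega>2 \<Phi>"
  obtains \<theta> where "\<theta> \<in> C1 A"
    "\<And>a b. a \<in> carr A \<Longrightarrow> b \<in> carr A \<Longrightarrow> \<omega>1 a b - \<omega>2 a b = cobdry A \<theta> a b"
    "\<And>x. x \<in> carr A \<times> carr (cdual A) \<Longrightarrow> \<Phi> x = text_shift \<theta> x"
proof -
  note F = lsca_facts[OF A(1)]
  define \<theta> where "\<theta> a = snd (\<Phi> (a, 0))" for a
  have \<Phi>: "\<Phi> (x + y) = \<Phi> x + \<Phi> y"
      "\<Phi> (act (text_alg A \<omega>1) p x) = act (text_alg A \<omega>2) p (\<Phi> x)"
      "map_poly \<Phi> (lprod (text_alg A \<omega>1) x y) = lprod (text_alg A \<omega>2) (\<Phi> x) (\<Phi> y)"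
    if "x \<in> carr A \<times> carr (cdual A)" "y \<in> carr A \<times> carr (cdual A)" for x y p
    using eq that
    by (auto simp: text_equivalence_def lsca_iso_def lsca_hom_def conf_mod_hom_def linear_on_def
        text_alg_def)
  have \<Phi>f: "\<Phi> (0, f) = (0, f)" if "f \<in> carr (cdual A)" for f
    using eq that by (simp add: text_equivalence_def)
  have \<Phi>a: "\<Phi> (a, 0) = (a, \<theta> a)" "\<theta> a \<in> carr (cdual A)" if "a \<in> carr A" for a
    using eq that by (cases "\<Phi> (a, 0)"; force simp: text_equivalence_def \<theta>_def)+
  have shift: "\<Phi> (a, f) = text_shift \<theta> (a, f)" if "a \<in> carr A" "f \<in> carr (cdual A)" for a f
    using \<Phi>(1)[of "(a, 0)" "(0, f)"] that \<Phi>a \<Phi>f F(4) zero_in_cdual[of A]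
    by (simp add: text_shift_def add.commute)
  have c1: "\<theta> \<in> C1 A"
    unfolding C1_def conf_mod_hom_def linear_on_def
  proof (intro CollectI conjI ballI allI)
    show "\<theta> x \<in> carr (cdual A)" if "x \<in> carr A" for x using \<Phi>a that by simp
    show "\<theta> (x + y) = \<theta> x + \<theta> y" if "x \<in> carr A" "y \<in> carr A" for x y
      using \<Phi>(1)[of "(x, 0)" "(y, 0)"] \<Phi>a F(3) that zero_in_cdual[of A] by simp
    show "\<theta> (act A p x) = act (cdual A) p (\<theta> x)" if "x \<in> carr A" for p x
    proof -
      have "act (cdual A) p 0 = 0" by (auto simp: cdual_def)
      then show ?thesis
        using \<Phi>(2)[of "(x, 0)" "(x, 0)" p] \<Phi>a F(2) that zero_in_cdual[of A]
        by (simp add: text_alg_def)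
    qed
  qed
  have "\<omega>1 a b - \<omega>2 a b = cobdry A \<theta> a b" if ab: "a \<in> carr A" "b \<in> carr A" for a b
  proof (rule poly_eqI)
    fix n
    have \<theta>0: "\<theta> 0 = 0" by (rule C1_zero[OF A(1) c1])
    \<comment> \<open>\<open>\<Phi>\<close> is known to be a shift only on the carrier, so the
      coefficients of the product must lie there before \<open>\<Phi>\<close> can be evaluated on
      them.\<close>
    have "coeff (\<omega>1 a b) n \<in> carr (cdual A)"
      using \<omega> ab by (auto simp: conf_sesquilinear_def polys_def)
    moreover have "\<Phi> 0 = 0"
      using \<Phi>f[OF zero_in_cdual] by (simp add: zero_prod_def)
    \<comment> \<open>With zero dual parts, the dual action drops out of the source product but acts
      on \<open>\<theta> b\<close> in the target product.\<close>
    ultimately show "coeff (\<omega>1 a b - \<omega>2 a b) n = coeff (cobdry A \<theta> a b) n"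
      using arg_cong[OF \<Phi>(3)[of "(a, 0)" "(b, 0)"], of "\<lambda>P. coeff P n"] ab zero_in_cdual[of A]
      by (simp add: coeff_map_poly lprod_text_alg \<Phi>a lstar_zero[OF A] shift F(7)
          text_shift_def cobdry_def \<theta>0 algebra_simps)
  qed
  then show thesis using that c1 shift by auto
qed

section \<open>Isometries and the equivalence criteria\<close>

text \<open>Expanding the form leaves the two cross terms \<open>\<theta> a b\<close> and
  \<open>pneg (\<theta> b a)\<close>, whose sum is twice the induced form.\<close>

lemma text_form_text_shift:
  "text_form (text_shift \<theta> (a, f)) (text_shift \<theta> (b, g))
    = text_form (a, f) (b, g) + smult 2 (form_of \<theta> a b)"
  by (simp add: text_form_def text_shift_def form_of_def)

theorem theorem6p6:
  fixes A :: "'a::ab_group_add conf_alg"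
    and \<omega>1 \<omega>2 :: "'a \<Rightarrow> 'a \<Rightarrow> ('a \<Rightarrow> complex poly) poly"
  assumes "lsca A" and "fin_gen A"
    and "invariant_cocycle A \<omega>1" and "invariant_cocycle A \<omega>2"
  shows "(text_equivalent A \<omega>1 \<omega>2 \<longleftrightarrow>
            (\<exists>\<theta>\<in>C1 A. \<forall>a\<in>carr A. \<forall>b\<in>carr A. \<omega>1 a b - \<omega>2 a b = cobdry A \<theta> a b))
       \<and> (\<forall>\<theta>\<in>C1 A. (\<forall>a\<in>carr A. \<forall>b\<in>carr A. \<omega>1 a b - \<omega>2 a b = cobdry A \<theta> a b) \<longrightarrow>
            conf_form A (form_of \<theta>) \<and> symmetric_form A (form_of \<theta>) \<and>
            invariant_form A (form_of \<theta>) \<and>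
            ((\<forall>a\<in>carr A. \<forall>b\<in>carr A. \<omega>1 a b = \<omega>2 a b) \<longleftrightarrow> one_cocycle A \<theta>))
       \<and> (text_isometrically_equivalent A \<omega>1 \<omega>2 \<longleftrightarrow>
            (\<exists>\<theta>\<in>C1 A. (\<forall>a\<in>carr A. \<forall>b\<in>carr A. \<omega>1 a b - \<omega>2 a b = cobdry A \<theta> a b) \<and>
               (\<forall>a\<in>carr A. \<forall>b\<in>carr A. form_of \<theta> a b = 0)))"
proof -
  have \<omega>: "conf_sesquilinear A (cdual A) \<omega>1"
    using assms(3) by (simp add: invariant_cocycle_def two_cocycle_def)
  have eqv: "text_equivalence A \<omega>1 \<omega>2 (text_shift \<theta>)"
    if "\<theta> \<in> C1 A" "\<forall>a\<in>carr A. \<forall>b\<in>carr A. \<omega>1 a b - \<omega>2 a b = cobdry A \<theta> a b" for \<theta>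
    using text_shift_equivalence[OF assms(1,2)] that by blast
  have i: "text_equivalent A \<omega>1 \<omega>2 \<longleftrightarrow>
      (\<exists>\<theta>\<in>C1 A. \<forall>a\<in>carr A. \<forall>b\<in>carr A. \<omega>1 a b - \<omega>2 a b = cobdry A \<theta> a b)"
    unfolding text_equivalent_def
    using eqv text_equivalenceE[OF assms(1,2) \<omega>] by metis
  have ii: "text_isometrically_equivalent A \<omega>1 \<omega>2 \<longleftrightarrow>
      (\<exists>\<theta>\<in>C1 A. (\<forall>a\<in>carr A. \<forall>b\<in>carr A. \<omega>1 a b - \<omega>2 a b = cobdry A \<theta> a b) \<and>
         (\<forall>a\<in>carr A. \<forall>b\<in>carr A. form_of \<theta> a b = 0))" (is "_ \<longleftrightarrow> ?R")
  proof
    assume "text_isometrically_equivalent A \<omega>1 \<omega>2"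
    then obtain \<Phi> where \<Phi>: "text_equivalence A \<omega>1 \<omega>2 \<Phi>" and
      iso: "\<forall>x\<in>carr (text_alg A \<omega>1). \<forall>y\<in>carr (text_alg A \<omega>1). text_form (\<Phi> x) (\<Phi> y) = text_form x y"
      by (auto simp: text_isometrically_equivalent_def)
    obtain \<theta> where \<theta>: "\<theta> \<in> C1 A"
      "\<And>a b. a \<in> carr A \<Longrightarrow> b \<in> carr A \<Longrightarrow> \<omega>1 a b - \<omega>2 a b = cobdry A \<theta> a b"
      "\<And>x. x \<in> carr A \<times> carr (cdual A) \<Longrightarrow> \<Phi> x = text_shift \<theta> x"
      using text_equivalenceE[OF assms(1,2) \<omega> \<Phi>] by blast
    \<comment> \<open>On pairs with zero dual part the form of the extension vanishes, so the
      isometry condition isolates the defect.\<close>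
    have "form_of \<theta> a b = 0" if "a \<in> carr A" "b \<in> carr A" for a b
      using iso[rule_format, of "(a, 0)" "(b, 0)"] that zero_in_cdual[of A]
      by (simp add: text_alg_def \<theta>(3) text_form_text_shift)
    then show ?R using \<theta> by blast
  next
    assume ?R
    then obtain \<theta> where \<theta>: "\<theta> \<in> C1 A"
      "\<forall>a\<in>carr A. \<forall>b\<in>carr A. \<omega>1 a b - \<omega>2 a b = cobdry A \<theta> a b"
      "\<forall>a\<in>carr A. \<forall>b\<in>carr A. form_of \<theta> a b = 0" by blast
    then have "\<forall>x\<in>carr (text_alg A \<omega>1). \<forall>y\<in>carr (text_alg A \<omega>1).
        text_form (text_shift \<theta> x) (text_shift \<theta> y) = text_form x y"
      by (auto simp: text_alg_def text_form_text_shift)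
    then show "text_isometrically_equivalent A \<omega>1 \<omega>2"
      using eqv[OF \<theta>(1,2)] by (auto simp: text_isometrically_equivalent_def)
  qed
  \<comment> \<open>The coboundary of \<open>\<theta>\<close> is the difference of the two cocycles,
    so one vanishes on the carrier exactly when the other does.\<close>
  have "(\<forall>a\<in>carr A. \<forall>b\<in>carr A. \<omega>1 a b = \<omega>2 a b) \<longleftrightarrow> one_cocycle A \<theta>"
    if "\<theta> \<in> C1 A" "\<forall>a\<in>carr A. \<forall>b\<in>carr A. \<omega>1 a b - \<omega>2 a b = cobdry A \<theta> a b" for \<theta>
    using that by (metis one_cocycle_def eq_iff_diff_eq_0)
  then show ?thesis
    using i ii conf_form_form_of[OF assms(1)] symmetric_form_of
      invariant_form_of[OF assms(1,2) _ assms(3,4)] by auto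
qed

end
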